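(* Let $\Omega=(a,b)$ be a bounded interval, $\lambda\ge0$, $\mu\in(0,1)$, and let $u\in L^2(\Omega)$ be real-valued. Then $$\left\|{}_a\mathbb{D}_x^{-\frac{\mu}{2},\lambda}u\right\|^2_{L^2(\Omega)}\sim\left({}_a\mathbb{D}_x^{-\mu,\lambda}u,\,u\right)=\left(u,\,{}_x\mathbb{D}_b^{-\mu,\lambda}u\right)\sim\left\|{}_x\mathbb{D}_b^{-\frac{\mu}{2},\lambda}u\right\|^2_{L^2(\Omega)},$$ where $(\cdot,\cdot)$ denotes the $L^2(\Omega)$ inner product.
   Context: For $\mu>0$ and $\lambda\ge0$, the left and right tempered Riemann–Liouville fractional integrals are ${}_a\mathbb{D}_x^{-\mu,\lambda}u(x)=\int_a^x\frac{(x-\xi)^{\mu-1}}{\Gamma(\mu)}e^{-\lambda(x-\xi)}u(\xi)\,d\xi$ and ${}_x\mathbb{D}_b^{-\mu,\lambda}u(x)=\int_x^b\frac{(\xi-x)^{\mu-1}}{\Gamma(\mu)}e^{-\lambda(\xi-x)}u(\xi)\,d\xi$. Notation: $A\sim B$ means $C_1B\le A\le C_2B$ with positive constants independent of $u$. *)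

theory Defs
  imports "HOL-Analysis.Analysis"
begin

definition left_tfi :: "real \<Rightarrow> real \<Rightarrow> real \<Rightarrow> (real \<Rightarrow> real) \<Rightarrow> real \<Rightarrow> real" where
  "left_tfi a mu lam u x =
     (LINT \<xi>:{a<..<x}|lborel. (x - \<xi>) powr (mu - 1) / Gamma mu * exp (- lam * (x - \<xi>)) * u \<xi>)"

definition right_tfi :: "real \<Rightarrow> real \<Rightarrow> real \<Rightarrow> (real \<Rightarrow> real) \<Rightarrow> real \<Rightarrow> real" where
  "right_tfi b mu lam u x =
     (LINT \<xi>:{x<..<b}|lborel. (\<xi> - x) powr (mu - 1) / Gamma mu * exp (- lam * (\<xi> - x)) * u \<xi>)"

definition L2_inner :: "real \<Rightarrow> real \<Rightarrow> (real \<Rightarrow> real) \<Rightarrow> (real \<Rightarrow> real) \<Rightarrow> real" where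
  "L2_inner a b f g = (LINT x:{a<..<b}|lborel. f x * g x)"

definition L2_norm_sq :: "real \<Rightarrow> real \<Rightarrow> (real \<Rightarrow> real) \<Rightarrow> real" where
  "L2_norm_sq a b f = (LINT x:{a<..<b}|lborel. (f x)^2)"

definition in_L2 :: "real \<Rightarrow> real \<Rightarrow> (real \<Rightarrow> real) \<Rightarrow> bool" where
  "in_L2 a b u \<longleftrightarrow> set_borel_measurable lborel {a<..<b} u \<and>
                     set_integrable lborel {a<..<b} (\<lambda>x. (u x)^2)"

end

theory Submission
  imports Defs
begin

text \<open>
  Extend \<open>u\<close> by zero to \<open>U\<close>, and let \<open>k\<^sub>p\<close> be the kernel of the tempered integral of order \<open>p\<close>.
  For \<open>s = \<mu>/2\<close>, the squared norm over the whole line of the left integral of order \<open>s\<close>, and likewise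
  of the right one, is the quadratic form of \<open>U\<close> with kernel
  \<open>G \<bar>y - z\<bar>\<close>, \<open>G d = \<integral> k\<^sub>s t * k\<^sub>s (t + d) dt\<close>, while twice the inner product is the form with kernel
  \<open>k\<^sub>\<mu> \<bar>y - z\<bar>\<close>. Both are superpositions of the positive definite kernels \<open>exp (- r * \<bar>y - z\<bar>)\<close>,
  \<open>r > \<lambda>\<close>, with weights proportional to \<open>(r - \<lambda>) powr - s * (r + \<lambda>) powr - s\<close> and \<open>(r - \<lambda>) powr - \<mu>\<close>.
  The first weight is at most a constant times the second, so the squared norms are bounded by a
  constant times the inner product; no Fourier transform is needed. Conversely, by the semigroup
  property the inner product is the integral over the interval of the product of the left and right
  integrals of order \<open>s\<close>; by AM-GM and the bound already obtained for one factor it is bounded by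
  a constant times the squared norm of the other.
\<close>

section \<open>Tempered kernel: Gamma and Beta integrals\<close>

text \<open>The cutoff at 0 turns the integrals over (a,x) and (x,b) into whole-line convolutions,
  so that translations, reflections and Fubini need no moving limits.\<close>

definition tker :: "real \<Rightarrow> real \<Rightarrow> real \<Rightarrow> real" where
  "tker p lam t = (if 0 < t then t powr (p - 1) / Gamma p * exp (- lam * t) else 0)"

lemma borel_measurable_tker [measurable]: "tker p lam \<in> borel_measurable borel"
  unfolding tker_def by measurable

lemma tker_nonneg: "0 < p \<Longrightarrow> 0 \<le> tker p lam t"
  by (simp add: tker_def Gamma_real_nonneg)

text \<open>This is the Gamma integral after the substitution t -> (lam + r) t. It serves for the
  mass of the kernel (r = 0), for overlaps of exponentials (p = 1) and for the Laplace weights (lam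
  = 0).\<close>

lemma tker_laplace:
  assumes "0 < p" "0 < lam + r"
  shows "has_bochner_integral lborel (\<lambda>t. tker p lam t * exp (- r * t)) ((lam + r) powr - p)"
proof -
  let ?q = "lam + r"
  let ?g = "\<lambda>t::real. indicator {0..} t * t powr (p - 1) / exp t"
  have "has_bochner_integral lborel ?g (Gamma p)"
    using assms Gamma_conv_nn_integral_real[of p] Gamma_real_pos[of p]
    by (intro has_bochner_integral_nn_integral) (auto simp: field_simps)
  then have "has_bochner_integral lborel (\<lambda>t. ?g (0 + ?q * t)) (Gamma p /\<^sub>R \<bar>?q\<bar>)"
    using assms by (subst lborel_has_bochner_integral_real_affine_iff[symmetric]) auto
  then have "has_bochner_integral lborel (\<lambda>t. ?q powr (1 - p) / Gamma p * ?g (0 + ?q * t))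
      (?q powr (1 - p) / Gamma p * (Gamma p /\<^sub>R \<bar>?q\<bar>))"
    by (rule has_bochner_integral_mult_right)
  moreover have "?q powr (1 - p) / Gamma p * ?g (0 + ?q * t) = tker p lam t * exp (- r * t)" for t
  proof (cases "0 < t")
    case True
    have "?q powr (1 - p) * (?q * t) powr (p - 1) = t powr (p - 1)"
      using assms True by (simp add: powr_mult powr_add[symmetric] mult.assoc[symmetric])
    moreover have "?q * t \<ge> 0" using True assms by simp
    ultimately show ?thesis using True
      by (simp add: tker_def field_simps exp_add[symmetric] exp_minus)
  next
    case False
    then have "?q * t < 0 \<or> t = 0" using assms by (auto simp: mult_less_0_iff)
    with False show ?thesis by (auto simp: tker_def indicator_def)
  qed
  moreover have "?q powr (1 - p) / Gamma p * (Gamma p /\<^sub>R \<bar>?q\<bar>) = ?q powr - p"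
  proof -
    have "q powr (1 - p) / c * (c /\<^sub>R \<bar>q\<bar>) = q powr - p" if "0 < q" "0 < c" for q c :: real
      using that by (simp add: field_simps powr_diff powr_minus)
    then show ?thesis using assms Gamma_real_pos[of p] by blast
  qed
  ultimately show ?thesis by simp
qed

text \<open>Semigroup property: the exponentials combine to \<open>exp (- lam * d)\<close>, and the
  powers give a Beta integral after scaling by d.\<close>

lemma tker_beta:
  assumes "0 < p" "0 < q"
  shows "has_bochner_integral lborel (\<lambda>t. tker p lam t * tker q lam (d - t)) (tker (p + q) lam d)"
proof (cases "0 < d")
  case False
  then have "(\<lambda>t. tker p lam t * tker q lam (d - t)) = (\<lambda>_. 0)" "tker (p + q) lam d = 0"
    by (auto simp: tker_def)
  then show ?thesis by (simp add: has_bochner_integral_zero)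
next
  case True
  let ?g = "\<lambda>t::real. indicator {0..1} t * (t powr (p - 1) * (1 - t) powr (q - 1))"
  have "has_bochner_integral lborel ?g (Beta p q)"
    using assms nn_integral_has_integral_lebesgue[OF _ has_integral_Beta_real[of p q]]
    by (intro has_bochner_integral_nn_integral) (auto simp: Beta_def)
  then have "has_bochner_integral lborel (\<lambda>t. ?g (0 + (1/d) * t)) (Beta p q /\<^sub>R \<bar>1/d\<bar>)"
    using True by (subst lborel_has_bochner_integral_real_affine_iff[symmetric]) auto
  \<comment> \<open>The exponent p + q - 2 undoes the scaling of both power factors; the dilation t
    -> t/d contributes the remaining factor d.\<close>
  then have *: "has_bochner_integral lborel
      (\<lambda>t. d powr (p + q - 2) * exp (- lam * d) / (Gamma p * Gamma q) * ?g (0 + (1/d) * t))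
      (d powr (p + q - 2) * exp (- lam * d) / (Gamma p * Gamma q) * (Beta p q /\<^sub>R \<bar>1/d\<bar>))"
    by (rule has_bochner_integral_mult_right)
  have "d powr (p + q - 2) * exp (- lam * d) / (Gamma p * Gamma q) * ?g (0 + (1/d) * t)
      = tker p lam t * tker q lam (d - t)" for t
  proof (cases "0 < t \<and> t < d")
    case True
    have 1: "0 < t / d" "0 < 1 - t / d" using True \<open>0 < d\<close> by auto
    have "d powr (p + q - 2) = d powr (p - 1) * d powr (q - 1)"
      by (simp add: powr_add[symmetric])
    moreover have "d powr (p - 1) * (t / d) powr (p - 1) = t powr (p - 1)"
      using True \<open>0 < d\<close> by (simp add: powr_divide)
    moreover have "d powr (q - 1) * (1 - t / d) powr (q - 1) = (d - t) powr (q - 1)"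
    proof -
      have "d * (1 - t / d) = d - t" using \<open>0 < d\<close> by (simp add: right_diff_distrib)
      then show ?thesis using 1 \<open>0 < d\<close> by (subst powr_mult[symmetric]) auto
    qed
    ultimately have "d powr (p + q - 2) * ((t / d) powr (p - 1) * (1 - t / d) powr (q - 1))
        = t powr (p - 1) * (d - t) powr (q - 1)"
      by (metis mult.assoc mult.left_commute)
    moreover have "exp (- lam * d) = exp (- lam * t) * exp (- lam * (d - t))"
      by (simp add: exp_add[symmetric] algebra_simps)
    ultimately show ?thesis using True 1
      by (simp add: tker_def indicator_def mult_ac)
  next
    case False
    \<comment> \<open>At t = 0 and t = d the closed indicator is 1, but \<open>0 powr x = 0\<close>
      makes the Beta integrand vanish, in agreement with the strict cutoff in
      \<open>tker\<close>.\<close>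
    then have "t < 0 \<or> t = 0 \<or> t = d \<or> d < t" by linarith
    with False \<open>0 < d\<close> show ?thesis by (auto simp: tker_def indicator_def field_simps)
  qed
  moreover have "d powr (p + q - 2) * exp (- lam * d) / (Gamma p * Gamma q) * (Beta p q /\<^sub>R \<bar>1/d\<bar>)
      = tker (p + q) lam d"
  proof -
    have "d powr (p + q - 2) * d = d powr (p + q - 1)"
      using True powr_add[of d "p + q - 2" 1] by (simp add: algebra_simps)
    moreover have "Gamma p \<noteq> 0" "Gamma q \<noteq> 0"
      using Gamma_real_pos[OF assms(1)] Gamma_real_pos[OF assms(2)] by auto
    ultimately show ?thesis using True
      by (simp add: tker_def Beta_def field_simps)
  qed
  ultimately show ?thesis using * by simp
qed

section \<open>Fubini for weighted forms and Gram forms\<close>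

text \<open>Since F is nonnegative with t-integral H, the t-integral of |F V| is |H V|.
  Integrability of H V is therefore exactly Tonelli's condition, even though V changes sign.\<close>

lemma fubini_weight:
  fixes F :: "real \<times> real \<Rightarrow> real \<Rightarrow> real" and V H :: "real \<times> real \<Rightarrow> real"
  assumes F [measurable]: "case_prod F \<in> borel_measurable ((lborel \<Otimes>\<^sub>M lborel) \<Otimes>\<^sub>M lborel)"
    and V [measurable]: "V \<in> borel_measurable (lborel \<Otimes>\<^sub>M lborel)"
    and nonneg: "\<And>p t. 0 \<le> F p t"
    and H: "AE p in lborel \<Otimes>\<^sub>M lborel. has_bochner_integral lborel (F p) (H p)"
    and HV: "integrable (lborel \<Otimes>\<^sub>M lborel) (\<lambda>p. H p * V p)"
  shows "integrable ((lborel \<Otimes>\<^sub>M lborel) \<Otimes>\<^sub>M lborel) (\<lambda>(p, t). F p t * V p)"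
    and "integrable lborel (\<lambda>t. \<integral>p. F p t * V p \<partial>(lborel \<Otimes>\<^sub>M lborel))"
    and "(\<integral>t. (\<integral>p. F p t * V p \<partial>(lborel \<Otimes>\<^sub>M lborel)) \<partial>lborel) = (\<integral>p. H p * V p \<partial>(lborel \<Otimes>\<^sub>M lborel))"
proof -
  interpret P: pair_sigma_finite "lborel \<Otimes>\<^sub>M lborel :: (real \<times> real) measure" "lborel :: real measure"
    by (intro pair_sigma_finite.intro sigma_finite_lborel) (simp add: lborel_prod sigma_finite_lborel)
  show int: "integrable ((lborel \<Otimes>\<^sub>M lborel) \<Otimes>\<^sub>M lborel) (\<lambda>(p, t). F p t * V p)"
  proof (rule P.Fubini_integrable)
    have "integrable (lborel \<Otimes>\<^sub>M lborel) (\<lambda>p. \<bar>H p * V p\<bar>)"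
      using HV by (rule integrable_abs)
    then show "integrable (lborel \<Otimes>\<^sub>M lborel) (\<lambda>p. \<integral>t. norm (case (p, t) of (p, t) \<Rightarrow> F p t * V p) \<partial>lborel)"
    proof (rule integrable_cong_AE_imp)
      show "AE p in lborel \<Otimes>\<^sub>M lborel. \<bar>H p * V p\<bar> = (\<integral>t. norm (case (p, t) of (p, t) \<Rightarrow> F p t * V p) \<partial>lborel)"
        using H
      proof eventually_elim
        case (elim p)
        have "0 \<le> integral\<^sup>L lborel (F p)"
          by (intro Bochner_Integration.integral_nonneg nonneg)
        with elim have "0 \<le> H p"
          by (simp add: has_bochner_integral_integral_eq)
        then show ?case using elim nonneg[of p]
          by (simp add: abs_mult has_bochner_integral_integral_eq)
      qed
    qed measurable
    show "AE p in lborel \<Otimes>\<^sub>M lborel. integrable lborel (\<lambda>t. case (p, t) of (p, t) \<Rightarrow> F p t * V p)"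
      using H by eventually_elim (auto simp: has_bochner_integral_iff)
  qed measurable
  show "integrable lborel (\<lambda>t. \<integral>p. F p t * V p \<partial>(lborel \<Otimes>\<^sub>M lborel))"
    using P.integrable_snd[OF int] .
  have "(\<integral>t. (\<integral>p. F p t * V p \<partial>(lborel \<Otimes>\<^sub>M lborel)) \<partial>lborel)
      = (\<integral>p. (\<integral>t. F p t * V p \<partial>lborel) \<partial>(lborel \<Otimes>\<^sub>M lborel))"
    using P.Fubini_integral[OF int] .
  also have "\<dots> = (\<integral>p. H p * V p \<partial>(lborel \<Otimes>\<^sub>M lborel))"
  proof (rule integral_cong_AE)
    show "AE p in lborel \<Otimes>\<^sub>M lborel. (\<integral>t. F p t * V p \<partial>lborel) = H p * V p"
      using H by eventually_elim (simp add: has_bochner_integral_integral_eq)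
    show "(\<lambda>p. H p * V p) \<in> borel_measurable (lborel \<Otimes>\<^sub>M lborel)"
      using HV by (rule borel_measurable_integrable)
  qed measurable
  finally show "(\<integral>t. (\<integral>p. F p t * V p \<partial>(lborel \<Otimes>\<^sub>M lborel)) \<partial>lborel) = (\<integral>p. H p * V p \<partial>(lborel \<Otimes>\<^sub>M lborel))" .
qed

text \<open>Multiplying out the two inner integrals gives a double integral in (y, z); exchanging it
  with the t-integral leaves the overlap H of the two kernels. With f = g the form is an integral of
  a square, which gives norms as well as positivity.\<close>

lemma gram_integral:
  fixes f g :: "real \<Rightarrow> real \<Rightarrow> real" and U :: "real \<Rightarrow> real" and H :: "real \<times> real \<Rightarrow> real"
  assumes f [measurable]: "case_prod f \<in> borel_measurable (lborel \<Otimes>\<^sub>M lborel)"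
    and g [measurable]: "case_prod g \<in> borel_measurable (lborel \<Otimes>\<^sub>M lborel)"
    and U [measurable]: "U \<in> borel_measurable lborel"
    and nonneg: "\<And>t y. 0 \<le> f t y" "\<And>t y. 0 \<le> g t y"
    and H: "AE p in lborel \<Otimes>\<^sub>M lborel. has_bochner_integral lborel (\<lambda>t. f t (fst p) * g t (snd p)) (H p)"
    and HU: "integrable (lborel \<Otimes>\<^sub>M lborel) (\<lambda>p. H p * (U (fst p) * U (snd p)))"
  shows "has_bochner_integral lborel (\<lambda>t. (\<integral>y. f t y * U y \<partial>lborel) * (\<integral>z. g t z * U z \<partial>lborel))
    (\<integral>p. H p * (U (fst p) * U (snd p)) \<partial>(lborel \<Otimes>\<^sub>M lborel))"
proof -
  interpret P: pair_sigma_finite "lborel \<Otimes>\<^sub>M lborel :: (real \<times> real) measure" "lborel :: real measure"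
    by (intro pair_sigma_finite.intro sigma_finite_lborel) (simp add: lborel_prod sigma_finite_lborel)
  let ?F = "\<lambda>p t. f t (fst p) * g t (snd p)" and ?V = "\<lambda>p. U (fst p) * U (snd p)"
  have F: "case_prod ?F \<in> borel_measurable ((lborel \<Otimes>\<^sub>M lborel) \<Otimes>\<^sub>M lborel)" by measurable
  have V: "?V \<in> borel_measurable (lborel \<Otimes>\<^sub>M lborel)" by measurable
  note fub = fubini_weight[OF F V _ H HU]
  \<comment> \<open>Splitting the planar integral into a product requires an integrable slice, which
    Fubini grants only for almost every t.\<close>
  have eq: "AE t in lborel. (\<integral>p. ?F p t * ?V p \<partial>(lborel \<Otimes>\<^sub>M lborel))
      = (\<integral>y. f t y * U y \<partial>lborel) * (\<integral>z. g t z * U z \<partial>lborel)"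
  proof -
    have "AE t in lborel. integrable (lborel \<Otimes>\<^sub>M lborel) (\<lambda>p. ?F p t * ?V p)"
      using P.AE_integrable_snd[OF fub(1)] nonneg by simp
    then show ?thesis
    proof eventually_elim
      case (elim t)
      have "(\<integral>p. ?F p t * ?V p \<partial>(lborel \<Otimes>\<^sub>M lborel))
          = (\<integral>y. (\<integral>z. f t y * U y * (g t z * U z) \<partial>lborel) \<partial>lborel)"
        using lborel_pair.integral_fst'[OF elim] by (simp add: mult_ac)
      then show ?case by simp
    qed
  qed
  have "has_bochner_integral lborel (\<lambda>t. \<integral>p. ?F p t * ?V p \<partial>(lborel \<Otimes>\<^sub>M lborel))
      (\<integral>p. H p * ?V p \<partial>(lborel \<Otimes>\<^sub>M lborel))"
    using fub(2,3) nonneg by (simp add: has_bochner_integral_iff)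
  then show ?thesis
    by (rule has_bochner_integral_cong_AE[THEN iffD1, rotated -1]) (use eq in measurable)
qed

section \<open>Correlations of translated kernels\<close>

text \<open>The diagonal must be discarded later: for \<open>2 * s < 1\<close> the square of
  \<open>tker s lam\<close> behaves like a multiple of t^(2s-2) near 0 and is not
  integrable.\<close>

lemma AE_fst_neq_snd: "AE p in lborel \<Otimes>\<^sub>M lborel. fst p \<noteq> (snd p :: real)"
proof (rule lborel_pair.AE_pair_measure)
  have "AE y in lborel. x \<noteq> y" for x :: real
    using AE_lborel_singleton[of x] by eventually_elim auto
  then show "AE x in lborel. AE y in lborel. fst (x, y) \<noteq> (snd (x, y) :: real)" by simp
qed measurable

text \<open>Translation by max(y,z), or reflection about min(y,z), moves one factor to t and the
  other to t + |y - z|. Left and right kernels thus have the same correlation, so one estimate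
  serves both sides.\<close>

lemma tker_correlation:
  assumes "has_bochner_integral lborel (\<lambda>t. tker p lam t * tker p lam (t + \<bar>y - z\<bar>)) h"
  shows "has_bochner_integral lborel (\<lambda>t. tker p lam (t - y) * tker p lam (t - z)) h"
    and "has_bochner_integral lborel (\<lambda>t. tker p lam (y - t) * tker p lam (z - t)) h"
proof -
  let ?f = "\<lambda>t. tker p lam t * tker p lam (t + \<bar>y - z\<bar>)"
  have "has_bochner_integral lborel (\<lambda>t. ?f (- max y z + 1 * t)) (h /\<^sub>R \<bar>1\<bar>)"
    using assms by (subst lborel_has_bochner_integral_real_affine_iff[symmetric]) auto
  moreover have "(\<lambda>t. ?f (- max y z + 1 * t)) = (\<lambda>t. tker p lam (t - y) * tker p lam (t - z))"
    by (rule ext) (auto simp: max_def abs_if mult.commute intro!: arg_cong2[where f = "(*)"] arg_cong[where f = "tker p lam"])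
  ultimately show "has_bochner_integral lborel (\<lambda>t. tker p lam (t - y) * tker p lam (t - z)) h"
    by simp
  have "has_bochner_integral lborel (\<lambda>t. ?f (min y z + (- 1) * t)) (h /\<^sub>R \<bar>- 1\<bar>)"
    using assms by (subst lborel_has_bochner_integral_real_affine_iff[symmetric]) auto
  moreover have "(\<lambda>t. ?f (min y z + (- 1) * t)) = (\<lambda>t. tker p lam (y - t) * tker p lam (z - t))"
    by (rule ext) (auto simp: min_def abs_if mult.commute intro!: arg_cong2[where f = "(*)"] arg_cong[where f = "tker p lam"])
  ultimately show "has_bochner_integral lborel (\<lambda>t. tker p lam (y - t) * tker p lam (z - t)) h"
    by simp
qed

text \<open>\<open>tker 1 r\<close> is the one-sided exponential. This exhibits exp(-r|y-z|), up to
  the factor 2r, as a Gram kernel and hence as positive definite.\<close>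

lemma exp_abs_correlation:
  assumes "0 < r"
  shows "has_bochner_integral lborel (\<lambda>t. tker 1 r (t - y) * tker 1 r (t - z))
    (exp (- r * \<bar>y - z\<bar>) / (2 * r))"
proof (rule tker_correlation(1))
  let ?d = "\<bar>y - z\<bar>"
  have "has_bochner_integral lborel (\<lambda>t. exp (- r * ?d) * (tker 1 r t * exp (- r * t)))
      (exp (- r * ?d) * ((r + r) powr - 1))"
    by (intro has_bochner_integral_mult_right tker_laplace) (use assms in auto)
  moreover have "exp (- r * ?d) * (tker 1 r t * exp (- r * t)) = tker 1 r t * tker 1 r (t + ?d)" for t
    by (auto simp: tker_def exp_add[symmetric] algebra_simps)
  moreover have "exp (- r * ?d) * ((r + r) powr - 1) = exp (- r * ?d) / (2 * r)"
    using assms by (simp add: powr_minus field_simps)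
  ultimately show "has_bochner_integral lborel (\<lambda>t. tker 1 r t * tker 1 r (t + ?d))
      (exp (- r * ?d) / (2 * r))" by (simp only:)
qed

section \<open>Laplace representations and comparison of their weights\<close>

text \<open>The density (r - lam)^(-p) / (Gamma p Gamma (1 - p)) on r > lam; writing it with
  \<open>tker (1 - p) 0\<close> makes the Gamma integral reusable.\<close>

definition laplace_weight :: "real \<Rightarrow> real \<Rightarrow> real \<Rightarrow> real" where
  "laplace_weight p lam r = tker (1 - p) 0 (r - lam) / Gamma p"

lemma borel_measurable_laplace_weight [measurable]: "laplace_weight p lam \<in> borel_measurable borel"
  unfolding laplace_weight_def by measurable

lemma laplace_weight_nonneg: "0 < p \<Longrightarrow> p < 1 \<Longrightarrow> 0 \<le> laplace_weight p lam r"
  by (simp add: laplace_weight_def tker_nonneg Gamma_real_nonneg)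

lemma laplace_weight_eq_0: "r \<le> lam \<Longrightarrow> laplace_weight p lam r = 0"
  by (simp add: laplace_weight_def tker_def)

text \<open>The power d^(p-1) is the Laplace transform of a multiple of r^(-p), integrable at 0
  because p < 1; shifting r by lam produces the tempering factor.\<close>

lemma tker_eq_laplace_laplace_weight:
  assumes "0 < p" "p < 1" "0 < d"
  shows "has_bochner_integral lborel (\<lambda>r. laplace_weight p lam r * exp (- r * d)) (tker p lam d)"
proof -
  let ?f = "\<lambda>t. tker (1 - p) 0 t * exp (- d * t)"
  have "has_bochner_integral lborel ?f ((0 + d) powr - (1 - p))"
    by (intro tker_laplace) (use assms in auto)
  then have "has_bochner_integral lborel (\<lambda>r. ?f (- lam + 1 * r)) ((0 + d) powr - (1 - p) /\<^sub>R \<bar>1\<bar>)"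
    by (subst lborel_has_bochner_integral_real_affine_iff[symmetric]) auto
  then have "has_bochner_integral lborel (\<lambda>r. exp (- lam * d) / Gamma p * ?f (- lam + 1 * r))
      (exp (- lam * d) / Gamma p * ((0 + d) powr - (1 - p) /\<^sub>R \<bar>1\<bar>))"
    by (rule has_bochner_integral_mult_right)
  moreover have "exp (- lam * d) / Gamma p * ?f (- lam + 1 * r) = laplace_weight p lam r * exp (- r * d)" for r
  proof -
    have "exp (- lam * d) * exp (- d * (r - lam)) = exp (- r * d)"
      by (simp add: exp_add[symmetric] algebra_simps)
    then show ?thesis by (simp add: laplace_weight_def mult_ac)
  qed
  moreover have "exp (- lam * d) / Gamma p * ((0 + d) powr - (1 - p) /\<^sub>R \<bar>1\<bar>) = tker p lam d"
    using assms by (simp add: tker_def)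
  ultimately show ?thesis by simp
qed

text \<open>The extra factor is the Laplace transform of \<open>tker s lam\<close> at r; it appears
  when one factor of the correlation is expanded into exponentials and the other is integrated
  against them.\<close>

definition corr_weight :: "real \<Rightarrow> real \<Rightarrow> real \<Rightarrow> real" where
  "corr_weight s lam r = laplace_weight s lam r * (lam + r) powr - s"

lemma borel_measurable_corr_weight [measurable]: "corr_weight s lam \<in> borel_measurable borel"
  unfolding corr_weight_def by measurable

text \<open>The ratio of the Gamma normalizations of the two weights. By the reflection formula it
  equals 1 / (2 cos (pi s)), so it blows up as s tends to 1/2.\<close>

definition coercivity_const :: "real \<Rightarrow> real" where
  "coercivity_const s = Gamma (2 * s) * Gamma (1 - 2 * s) / (Gamma s * Gamma (1 - s))"

lemma coercivity_const_pos: "0 < s \<Longrightarrow> 2 * s < 1 \<Longrightarrow> 0 < coercivity_const s"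
  unfolding coercivity_const_def by (intro divide_pos_pos mult_pos_pos Gamma_real_pos) auto

lemma corr_weight_nonneg: "0 < s \<Longrightarrow> s < 1 \<Longrightarrow> 0 \<le> corr_weight s lam r"
  unfolding corr_weight_def by (simp add: laplace_weight_nonneg)

text \<open>Because lam >= 0, r + lam is at least r - lam, and a negative power reverses the order;
  the rest is a comparison of Gamma factors. For r <= lam both weights vanish.\<close>

lemma corr_weight_le:
  assumes "0 < s" "2 * s < 1" "0 \<le> lam"
  shows "corr_weight s lam r \<le> coercivity_const s * laplace_weight (2 * s) lam r"
proof (cases "lam < r")
  case True
  have "(r - lam) powr - s * (lam + r) powr - s \<le> (r - lam) powr - s * (r - lam) powr - s"
    using assms True by (intro mult_left_mono powr_mono2') auto
  also have "\<dots> = (r - lam) powr - (2 * s)"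
    by (simp add: powr_add[symmetric])
  finally have le: "(r - lam) powr - s * (lam + r) powr - s \<le> (r - lam) powr - (2 * s)" .
  have pos: "0 < Gamma s" "0 < Gamma (1 - s)" "0 < Gamma (2 * s)" "0 < Gamma (1 - 2 * s)"
    using assms by (auto intro!: Gamma_real_pos)
  have "corr_weight s lam r = (r - lam) powr - s * (lam + r) powr - s / (Gamma s * Gamma (1 - s))"
    using True by (simp add: corr_weight_def laplace_weight_def tker_def)
  also have "\<dots> \<le> (r - lam) powr - (2 * s) / (Gamma s * Gamma (1 - s))"
    using le pos by (intro divide_right_mono) auto
  also have "\<dots> = coercivity_const s * laplace_weight (2 * s) lam r"
    using True pos by (simp add: coercivity_const_def laplace_weight_def tker_def field_simps)
  finally show ?thesis .
qed (simp add: corr_weight_def laplace_weight_eq_0)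

text \<open>The function G of the overview, defined by its Laplace representation because that is
  the form in which it is compared with the kernel of order 2s.\<close>

definition autocorr :: "real \<Rightarrow> real \<Rightarrow> real \<Rightarrow> real" where
  "autocorr s lam d = (\<integral>r. corr_weight s lam r * exp (- r * d) \<partial>lborel)"

lemma borel_measurable_autocorr [measurable]: "autocorr s lam \<in> borel_measurable borel"
  unfolding autocorr_def by measurable

lemma autocorr_laplace:
  assumes "0 < s" "2 * s < 1" "0 \<le> lam" "0 < d"
  shows "has_bochner_integral lborel (\<lambda>r. corr_weight s lam r * exp (- r * d)) (autocorr s lam d)"
proof -
  have "integrable lborel (\<lambda>r. coercivity_const s * (laplace_weight (2 * s) lam r * exp (- r * d)))"
    using tker_eq_laplace_laplace_weight[of "2 * s" d lam] assms by (auto simp: has_bochner_integral_iff)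
  then have "integrable lborel (\<lambda>r. corr_weight s lam r * exp (- r * d))"
  proof (rule Bochner_Integration.integrable_bound)
    show "AE r in lborel. norm (corr_weight s lam r * exp (- r * d))
        \<le> norm (coercivity_const s * (laplace_weight (2 * s) lam r * exp (- r * d)))"
    proof (rule AE_I2)
      fix r
      have "0 \<le> corr_weight s lam r" "0 \<le> coercivity_const s" "0 \<le> laplace_weight (2 * s) lam r"
        using assms coercivity_const_pos[of s] by (auto simp: corr_weight_nonneg laplace_weight_nonneg)
      then show "norm (corr_weight s lam r * exp (- r * d))
        \<le> norm (coercivity_const s * (laplace_weight (2 * s) lam r * exp (- r * d)))"
        using mult_right_mono[OF corr_weight_le[OF assms(1-3), of r], of "exp (- r * d)"]
        by (simp add: abs_mult mult.assoc)
    qed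
  qed measurable
  then show ?thesis by (simp add: has_bochner_integral_iff autocorr_def)
qed

text \<open>Both sides are iterated integrals of one nonnegative function \<open>?f\<close> of (r,
  t): integrating first in r restores \<open>tker s lam (t + d)\<close>, integrating first in t
  produces \<open>corr_weight\<close>.\<close>

lemma tker_correlation_autocorr:
  assumes "0 < s" "2 * s < 1" "0 \<le> lam" "0 < d"
  shows "has_bochner_integral lborel (\<lambda>t. tker s lam t * tker s lam (t + d)) (autocorr s lam d)"
proof -
  let ?f = "\<lambda>r t. laplace_weight s lam r * exp (- r * d) * (tker s lam t * exp (- r * t))"
  have nonneg: "0 \<le> ?f r t" for r t
    using assms by (simp add: laplace_weight_nonneg tker_nonneg)
  have inner: "has_bochner_integral lborel (?f r) (corr_weight s lam r * exp (- r * d))" for r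
  proof (cases "lam < r")
    case True
    then have "has_bochner_integral lborel (?f r) (laplace_weight s lam r * exp (- r * d) * (lam + r) powr - s)"
      using assms by (intro has_bochner_integral_mult_right tker_laplace) auto
    then show ?thesis by (simp add: corr_weight_def mult_ac)
  qed (simp add: laplace_weight_eq_0 corr_weight_def has_bochner_integral_zero)
  have int: "integrable (lborel \<Otimes>\<^sub>M lborel) (\<lambda>(r, t). ?f r t)"
  proof (rule lborel_pair.Fubini_integrable)
    show "AE r in lborel. integrable lborel (\<lambda>t. case (r, t) of (r, t) \<Rightarrow> ?f r t)"
      using inner by (auto simp: has_bochner_integral_iff)
    have "(\<lambda>r. \<integral>t. norm (case (r, t) of (r, t) \<Rightarrow> ?f r t) \<partial>lborel)
        = (\<lambda>r. corr_weight s lam r * exp (- r * d))"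
      by (simp only: prod.case real_norm_def abs_of_nonneg[OF nonneg] has_bochner_integral_integral_eq[OF inner])
    then show "integrable lborel (\<lambda>r. \<integral>t. norm (case (r, t) of (r, t) \<Rightarrow> ?f r t) \<partial>lborel)"
      using autocorr_laplace[OF assms] by (simp only: has_bochner_integral_iff)
  qed measurable
  have outer: "(\<integral>r. ?f r t \<partial>lborel) = tker s lam t * tker s lam (t + d)" for t
  proof (cases "0 < t")
    case True
    have "has_bochner_integral lborel (\<lambda>r. tker s lam t * (laplace_weight s lam r * exp (- r * (t + d))))
        (tker s lam t * tker s lam (t + d))"
      using assms True by (intro has_bochner_integral_mult_right tker_eq_laplace_laplace_weight) auto
    moreover have "tker s lam t * (laplace_weight s lam r * exp (- r * (t + d))) = ?f r t" for r
      by (simp add: exp_add exp_diff exp_minus field_simps)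
    ultimately show ?thesis by (simp only: has_bochner_integral_integral_eq)
  qed (simp add: tker_def)
  have "(\<integral>t. (\<integral>r. ?f r t \<partial>lborel) \<partial>lborel) = (\<integral>r. (\<integral>t. ?f r t \<partial>lborel) \<partial>lborel)"
    by (rule lborel_pair.Fubini_integral[OF int])
  also have "\<dots> = autocorr s lam d"
    using inner by (simp only: has_bochner_integral_iff autocorr_def)
  finally show ?thesis
    using lborel_pair.integrable_snd[OF int] by (simp only: outer has_bochner_integral_iff)
qed

section \<open>Positive definiteness of Laplace superpositions\<close>

text \<open>Each exp(-r|y-z|) with r > 0 is positive definite, and a nonnegative weight on r > 0
  preserves this under integration in r.\<close>

lemma laplace_positive_definite:
  fixes U W :: "real \<Rightarrow> real" and H :: "real \<times> real \<Rightarrow> real"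
  assumes W [measurable]: "W \<in> borel_measurable lborel"
    and W_nonneg: "\<And>r. 0 \<le> W r" and W_0: "\<And>r. r \<le> 0 \<Longrightarrow> W r = 0"
    and H: "AE p in lborel \<Otimes>\<^sub>M lborel. has_bochner_integral lborel
        (\<lambda>r. W r * exp (- r * \<bar>fst p - snd p\<bar>)) (H p)"
    and U: "integrable lborel U"
    and HU: "integrable (lborel \<Otimes>\<^sub>M lborel) (\<lambda>p. H p * (U (fst p) * U (snd p)))"
  shows "0 \<le> (\<integral>p. H p * (U (fst p) * U (snd p)) \<partial>(lborel \<Otimes>\<^sub>M lborel))"
proof -
  have [measurable]: "U \<in> borel_measurable lborel" using U by auto
  let ?E = "\<lambda>p r. exp (- r * \<bar>fst p - snd p\<bar>)" and ?V = "\<lambda>p. U (fst p) * U (snd p)"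
  have V: "integrable (lborel \<Otimes>\<^sub>M lborel) ?V"
  proof (rule lborel_pair.Fubini_integrable)
    show "integrable lborel (\<lambda>x. \<integral>y. norm (U (fst (x, y)) * U (snd (x, y))) \<partial>lborel)"
      using U by (simp add: abs_mult integrable_abs)
  qed (use U in auto)
  have exp_nonneg: "0 \<le> (\<integral>p. ?E p r * ?V p \<partial>(lborel \<Otimes>\<^sub>M lborel))" if r: "0 < r" for r
  proof -
    have "has_bochner_integral lborel
        (\<lambda>t. (\<integral>y. tker 1 r (t - y) * U y \<partial>lborel) * (\<integral>z. tker 1 r (t - z) * U z \<partial>lborel))
        (\<integral>p. exp (- r * \<bar>fst p - snd p\<bar>) / (2 * r) * ?V p \<partial>(lborel \<Otimes>\<^sub>M lborel))"
    proof (rule gram_integral)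
      show "integrable (lborel \<Otimes>\<^sub>M lborel) (\<lambda>p. exp (- r * \<bar>fst p - snd p\<bar>) / (2 * r) * ?V p)"
      \<comment> \<open>For fixed r the kernel is bounded by 1/(2r), so integrability of U(y) U(z)
        on the plane is enough.\<close>
      proof (rule Bochner_Integration.integrable_bound)
        show "integrable (lborel \<Otimes>\<^sub>M lborel) (\<lambda>p. 1 / (2 * r) * ?V p)"
          using V by (rule integrable_mult_right)
        show "AE p in lborel \<Otimes>\<^sub>M lborel. norm (exp (- r * \<bar>fst p - snd p\<bar>) / (2 * r) * ?V p)
            \<le> norm (1 / (2 * r) * ?V p)"
          using r by (intro AE_I2) (auto simp: abs_mult intro!: divide_right_mono mult_left_le_one_le)
      qed measurable
    qed (use exp_abs_correlation[OF r] tker_nonneg[of 1] in auto)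
    from has_bochner_integral_integral_eq[OF this, symmetric]
    have "0 \<le> (\<integral>p. exp (- r * \<bar>fst p - snd p\<bar>) / (2 * r) * ?V p \<partial>(lborel \<Otimes>\<^sub>M lborel))"
      by (simp only:) (intro Bochner_Integration.integral_nonneg zero_le_square)
    also have "\<dots> = 1 / (2 * r) * (\<integral>p. ?E p r * ?V p \<partial>(lborel \<Otimes>\<^sub>M lborel))"
      by (subst integral_mult_right_zero[symmetric]) (simp add: mult_ac)
    finally show ?thesis using r by (simp add: zero_le_divide_iff)
  qed
  have "(\<integral>p. H p * ?V p \<partial>(lborel \<Otimes>\<^sub>M lborel))
      = (\<integral>r. (\<integral>p. (W r * ?E p r) * ?V p \<partial>(lborel \<Otimes>\<^sub>M lborel)) \<partial>lborel)"
    by (rule fubini_weight(3)[symmetric]) (use H HU W_nonneg in auto)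
  also have "\<dots> = (\<integral>r. W r * (\<integral>p. ?E p r * ?V p \<partial>(lborel \<Otimes>\<^sub>M lborel)) \<partial>lborel)"
    by (simp add: mult.assoc)
  also have "\<dots> \<ge> 0"
  proof (rule Bochner_Integration.integral_nonneg)
    show "0 \<le> W r * (\<integral>p. ?E p r * ?V p \<partial>(lborel \<Otimes>\<^sub>M lborel))" for r
      using exp_nonneg[of r] W_nonneg[of r] W_0[of r] by (cases "0 < r") auto
  qed
  finally show ?thesis .
qed

section \<open>Integrability of the forms on a bounded interval\<close>

text \<open>For lam = 0 the kernel has infinite mass on the line. At distances up to L it is
  dominated by the kernel with tempering 1, since exp(-lam t) <= 1 <= exp(L - t) for 0 < t <=
  L.\<close>

lemma tker_le_exp_tker:
  assumes "0 < p" "0 \<le> lam" "t \<le> L"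
  shows "tker p lam t \<le> exp L * tker p 1 t"
proof (cases "0 < t")
  case True
  have "exp (- lam * t) \<le> exp L * exp (- 1 * t)"
    using assms mult_nonneg_nonneg[OF assms(2) less_imp_le[OF True]] unfolding exp_add[symmetric] by (subst exp_le_cancel_iff) auto
  moreover have "0 \<le> t powr (p - 1) / Gamma p"
    using assms by (simp add: Gamma_real_nonneg)
  ultimately have "t powr (p - 1) / Gamma p * exp (- lam * t) \<le> t powr (p - 1) / Gamma p * (exp L * exp (- 1 * t))"
    by (rule mult_left_mono)
  then show ?thesis using True by (simp add: tker_def mult_ac)
qed (simp add: tker_def)

text \<open>A Schur-type bound: |U(y) U(z)| <= U(y)^2 + U(z)^2, and each square is integrated
  against the even kernel D, whose mass is 2.\<close>

lemma integrable_kernel_form: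
  fixes U :: "real \<Rightarrow> real"
  assumes U [measurable]: "U \<in> borel_measurable lborel" and U2: "integrable lborel (\<lambda>x. (U x)\<^sup>2)"
    and U0: "\<forall>x. x \<notin> {a<..<b} \<longrightarrow> U x = 0" and "0 < p" "0 \<le> lam"
  shows "integrable (lborel \<Otimes>\<^sub>M lborel) (\<lambda>q. tker p lam \<bar>fst q - snd q\<bar> * (U (fst q) * U (snd q)))"
proof -
  define D where "D = (\<lambda>t. tker p 1 t + tker p 1 (- t))"
  have [measurable]: "D \<in> borel_measurable borel" unfolding D_def by measurable
  have D_nonneg: "0 \<le> D t" for t using \<open>0 < p\<close> by (simp add: D_def tker_nonneg)
  have D_even: "D (y - z) = D (z - y)" for y z by (simp add: D_def)
  have "has_bochner_integral lborel (tker p 1) 1"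
    using tker_laplace[of p 1 0] \<open>0 < p\<close> by simp
  moreover from this have "has_bochner_integral lborel (\<lambda>t. tker p 1 (0 + (- 1) * t)) (1 /\<^sub>R \<bar>- 1\<bar>)"
    by (subst lborel_has_bochner_integral_real_affine_iff[symmetric]) auto
  ultimately have D: "has_bochner_integral lborel D 2"
    unfolding D_def using has_bochner_integral_add by fastforce
  have D_shift: "has_bochner_integral lborel (\<lambda>z. D (y - z)) 2" for y
  proof -
    have "has_bochner_integral lborel (\<lambda>t. D (y + (- 1) * t)) (2 /\<^sub>R \<bar>- 1\<bar>)"
      using D by (subst lborel_has_bochner_integral_real_affine_iff[symmetric]) auto
    then show ?thesis by simp
  qed
  have int1: "integrable (lborel \<Otimes>\<^sub>M lborel) (\<lambda>(y, z). (U y)\<^sup>2 * D (y - z))"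
  proof (rule lborel_pair.Fubini_integrable)
    have inner: "has_bochner_integral lborel (\<lambda>z. (U y)\<^sup>2 * D (y - z)) ((U y)\<^sup>2 * 2)" for y
      by (intro has_bochner_integral_mult_right D_shift)
    show "AE y in lborel. integrable lborel (\<lambda>z. case (y, z) of (y, z) \<Rightarrow> (U y)\<^sup>2 * D (y - z))"
      using inner by (auto simp only: has_bochner_integral_iff prod.case intro!: AE_I2)
    have "0 \<le> (U y)\<^sup>2 * D (y - z)" for y z by (simp add: D_nonneg)
    then have "(\<lambda>y. \<integral>z. norm (case (y, z) of (y, z) \<Rightarrow> (U y)\<^sup>2 * D (y - z)) \<partial>lborel) = (\<lambda>y. (U y)\<^sup>2 * 2)"
      by (simp only: prod.case real_norm_def abs_of_nonneg has_bochner_integral_integral_eq[OF inner])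
    then show "integrable lborel (\<lambda>y. \<integral>z. norm (case (y, z) of (y, z) \<Rightarrow> (U y)\<^sup>2 * D (y - z)) \<partial>lborel)"
      using U2 by simp
  qed measurable
  have int2: "integrable (lborel \<Otimes>\<^sub>M lborel) (\<lambda>(y, z). (U z)\<^sup>2 * D (z - y))"
    using lborel_pair.integrable_product_swap[OF int1] by simp
  have "integrable (lborel \<Otimes>\<^sub>M lborel)
      (\<lambda>q. exp (b - a) * ((case q of (y, z) \<Rightarrow> (U y)\<^sup>2 * D (y - z)) + (case q of (y, z) \<Rightarrow> (U z)\<^sup>2 * D (z - y))))"
    by (intro integrable_mult_right Bochner_Integration.integrable_add int1 int2)
  then show ?thesis
  proof (rule Bochner_Integration.integrable_bound)
    show "AE q in lborel \<Otimes>\<^sub>M lborel. norm (tker p lam \<bar>fst q - snd q\<bar> * (U (fst q) * U (snd q)))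
      \<le> norm (exp (b - a) * ((case q of (y, z) \<Rightarrow> (U y)\<^sup>2 * D (y - z)) + (case q of (y, z) \<Rightarrow> (U z)\<^sup>2 * D (z - y))))"
    proof (rule AE_I2)
      fix q :: "real \<times> real"
      obtain y z where q: "q = (y, z)" by (cases q)
      have le: "tker p lam \<bar>y - z\<bar> * \<bar>U y * U z\<bar> \<le> exp (b - a) * D (y - z) * ((U y)\<^sup>2 + (U z)\<^sup>2)"
      proof (cases "y \<in> {a<..<b} \<and> z \<in> {a<..<b}")
        case True
        then have "tker p lam \<bar>y - z\<bar> \<le> exp (b - a) * tker p 1 \<bar>y - z\<bar>"
          using assms by (intro tker_le_exp_tker) auto
        also have "\<dots> \<le> exp (b - a) * D (y - z)"
          using tker_nonneg[OF \<open>0 < p\<close>] by (intro mult_left_mono) (auto simp: D_def abs_if)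
        finally have 1: "tker p lam \<bar>y - z\<bar> \<le> exp (b - a) * D (y - z)" .
        have "2 * (\<bar>U y\<bar> * \<bar>U z\<bar>) \<le> (U y)\<^sup>2 + (U z)\<^sup>2"
          using sum_squares_bound[of "\<bar>U y\<bar>" "\<bar>U z\<bar>"] by simp
        moreover have "0 \<le> \<bar>U y\<bar> * \<bar>U z\<bar>" by simp
        ultimately have 2: "\<bar>U y * U z\<bar> \<le> (U y)\<^sup>2 + (U z)\<^sup>2"
          unfolding abs_mult by linarith
        show ?thesis
          by (intro mult_mono 1 2) (simp_all add: D_nonneg)
      next
        case False
        then have "U y * U z = 0" using U0 by auto
        then show ?thesis by (simp only: abs_zero mult_zero_right) (simp add: D_nonneg)
      qed
      have "norm (tker p lam \<bar>y - z\<bar> * (U y * U z)) = tker p lam \<bar>y - z\<bar> * \<bar>U y * U z\<bar>"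
        using tker_nonneg[OF \<open>0 < p\<close>] by (simp add: abs_mult)
      also note le
      also have "exp (b - a) * D (y - z) * ((U y)\<^sup>2 + (U z)\<^sup>2)
          = exp (b - a) * ((U y)\<^sup>2 * D (y - z) + (U z)\<^sup>2 * D (z - y))"
        using D_even[of z y] by (simp add: algebra_simps)
      finally show "norm (tker p lam \<bar>fst q - snd q\<bar> * (U (fst q) * U (snd q)))
          \<le> norm (exp (b - a) * ((case q of (y, z) \<Rightarrow> (U y)\<^sup>2 * D (y - z)) + (case q of (y, z) \<Rightarrow> (U z)\<^sup>2 * D (z - y))))"
        unfolding q by simp
    qed
  qed measurable
qed

lemma integrable_of_square_integrable:
  fixes U :: "real \<Rightarrow> real"
  assumes U [measurable]: "U \<in> borel_measurable lborel" and U2: "integrable lborel (\<lambda>x. (U x)\<^sup>2)"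
    and U0: "\<forall>x. x \<notin> {a<..<b} \<longrightarrow> U x = 0"
  shows "integrable lborel U"
proof (rule Bochner_Integration.integrable_bound)
  show "integrable lborel (\<lambda>x. indicator {a<..<b} x + (U x)\<^sup>2)"
    by (cases "a \<le> b"; intro Bochner_Integration.integrable_add U2 integrable_real_indicator) auto
  show "AE x in lborel. norm (U x) \<le> norm (indicator {a<..<b} x + (U x)\<^sup>2)"
  proof (rule AE_I2)
    fix x
    have "2 * \<bar>U x\<bar> \<le> 1 + (U x)\<^sup>2" using sum_squares_bound[of 1 "\<bar>U x\<bar>"] by simp
    moreover have "0 \<le> \<bar>U x\<bar>" by simp
    ultimately have "\<bar>U x\<bar> \<le> 1 + (U x)\<^sup>2" by linarith
    then show "norm (U x) \<le> norm (indicator {a<..<b} x + (U x)\<^sup>2)"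
      using U0[rule_format, of x] by (cases "x \<in> {a<..<b}") auto
  qed
qed measurable

section \<open>Whole-line operators, the energy form and adjointness\<close>

definition lconv :: "real \<Rightarrow> real \<Rightarrow> (real \<Rightarrow> real) \<Rightarrow> real \<Rightarrow> real" where
  "lconv p lam U x = (\<integral>y. tker p lam (x - y) * U y \<partial>lborel)"

definition rconv :: "real \<Rightarrow> real \<Rightarrow> (real \<Rightarrow> real) \<Rightarrow> real \<Rightarrow> real" where
  "rconv p lam U x = (\<integral>y. tker p lam (y - x) * U y \<partial>lborel)"

text \<open>The bound x <= b ensures that (a,x) lies inside (a,b), so cutting u off at b changes
  nothing.\<close>

lemma left_tfi_eq_lconv:
  assumes "x \<le> b"
  shows "left_tfi a p lam u x = lconv p lam (\<lambda>y. indicator {a<..<b} y *\<^sub>R u y) x"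
  unfolding left_tfi_def lconv_def set_lebesgue_integral_def
  by (intro Bochner_Integration.integral_cong) (use assms in \<open>auto simp: tker_def indicator_def\<close>)

lemma right_tfi_eq_rconv:
  assumes "a \<le> x"
  shows "right_tfi b p lam u x = rconv p lam (\<lambda>y. indicator {a<..<b} y *\<^sub>R u y) x"
  unfolding right_tfi_def rconv_def set_lebesgue_integral_def
  by (intro Bochner_Integration.integral_cong) (use assms in \<open>auto simp: tker_def indicator_def\<close>)

text \<open>The common value of both inner products, as a planar integral; the cutoff in
  \<open>tker\<close> restricts it to pairs with \<open>fst q < snd q\<close>.\<close>

definition energy :: "real \<Rightarrow> real \<Rightarrow> (real \<Rightarrow> real) \<Rightarrow> real" where
  "energy p lam U = (\<integral>q. tker p lam (snd q - fst q) * (U (fst q) * U (snd q)) \<partial>(lborel \<Otimes>\<^sub>M lborel))"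

context
  fixes U :: "real \<Rightarrow> real" and a b p lam :: real
  assumes U [measurable]: "U \<in> borel_measurable lborel" and U2: "integrable lborel (\<lambda>x. (U x)\<^sup>2)"
    and U0: "\<forall>x. x \<notin> {a<..<b} \<longrightarrow> U x = 0" and p: "0 < p" and lam: "0 \<le> lam"
begin

lemma integrable_energy:
  "integrable (lborel \<Otimes>\<^sub>M lborel) (\<lambda>q. tker p lam (snd q - fst q) * (U (fst q) * U (snd q)))"
proof (rule Bochner_Integration.integrable_bound[OF integrable_kernel_form[OF U U2 U0 p lam]])
  show "AE q in lborel \<Otimes>\<^sub>M lborel. norm (tker p lam (snd q - fst q) * (U (fst q) * U (snd q)))
      \<le> norm (tker p lam \<bar>fst q - snd q\<bar> * (U (fst q) * U (snd q)))"
    unfolding norm_mult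
    by (intro AE_I2 mult_right_mono) (use tker_nonneg[OF p] in \<open>auto simp: abs_if tker_def\<close>)
qed measurable

lemma energy_eq_rconv: "(\<integral>x. U x * rconv p lam U x \<partial>lborel) = energy p lam U"
proof -
  have "(\<integral>x. U x * rconv p lam U x \<partial>lborel)
      = (\<integral>x. (\<integral>y. tker p lam (y - x) * (U x * U y) \<partial>lborel) \<partial>lborel)"
    unfolding rconv_def by (subst integral_mult_right_zero[symmetric]) (simp add: mult_ac)
  also have "\<dots> = energy p lam U"
    using lborel_pair.integral_fst'[OF integrable_energy] by (simp add: energy_def)
  finally show ?thesis .
qed

lemma integrable_energy_swap:
  "integrable (lborel \<Otimes>\<^sub>M lborel) (\<lambda>q. tker p lam (fst q - snd q) * (U (fst q) * U (snd q)))"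
  using lborel_pair.integrable_product_swap[OF integrable_energy] by (simp add: case_prod_beta' mult_ac)

text \<open>Reflection in the diagonal exchanges the left and right kernels and fixes U(y) U(z).
  This is the adjointness of the two fractional integrals.\<close>

lemma energy_swap:
  "(\<integral>q. tker p lam (fst q - snd q) * (U (fst q) * U (snd q)) \<partial>(lborel \<Otimes>\<^sub>M lborel)) = energy p lam U"
  using lborel_pair.integral_product_swap[OF borel_measurable_integrable[OF integrable_energy]]
  by (simp add: energy_def case_prod_beta' mult_ac)

lemma energy_eq_lconv: "(\<integral>x. lconv p lam U x * U x \<partial>lborel) = energy p lam U"
proof -
  have "(\<integral>x. lconv p lam U x * U x \<partial>lborel)
      = (\<integral>x. (\<integral>y. tker p lam (x - y) * (U x * U y) \<partial>lborel) \<partial>lborel)"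
    unfolding lconv_def by (subst integral_mult_left_zero[symmetric]) (simp add: mult_ac)
  also have "\<dots> = energy p lam U"
    using lborel_pair.integral_fst'[OF integrable_energy_swap] energy_swap by simp
  finally show ?thesis .
qed

text \<open>The even kernel splits into its two one-sided halves, each contributing one copy of the
  energy.\<close>

lemma energy_symmetric:
  "(\<integral>q. tker p lam \<bar>fst q - snd q\<bar> * (U (fst q) * U (snd q)) \<partial>(lborel \<Otimes>\<^sub>M lborel)) = 2 * energy p lam U"
proof -
  have "(\<integral>q. tker p lam \<bar>fst q - snd q\<bar> * (U (fst q) * U (snd q)) \<partial>(lborel \<Otimes>\<^sub>M lborel))
     = (\<integral>q. tker p lam (snd q - fst q) * (U (fst q) * U (snd q))
           + tker p lam (fst q - snd q) * (U (fst q) * U (snd q)) \<partial>(lborel \<Otimes>\<^sub>M lborel))"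
    by (intro Bochner_Integration.integral_cong) (auto simp: tker_def abs_if)
  also have "\<dots> = energy p lam U + energy p lam U"
    by (subst Bochner_Integration.integral_add[OF integrable_energy integrable_energy_swap])
       (simp add: energy_swap, simp add: energy_def)
  finally show ?thesis by simp
qed

end

section \<open>Two-sided estimates between norms and energy\<close>

context
  fixes U :: "real \<Rightarrow> real" and a b s lam :: real
  assumes U [measurable]: "U \<in> borel_measurable lborel" and U2: "integrable lborel (\<lambda>x. (U x)\<^sup>2)"
    and U0: "\<forall>x. x \<notin> {a<..<b} \<longrightarrow> U x = 0" and s: "0 < s" "2 * s < 1" and lam: "0 \<le> lam"
begin

text \<open>The overlap of the left kernel centred at y with the right kernel centred at z is, by
  the Beta integral, the kernel of order 2s at z - y.\<close>

lemma energy_semigroup: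
  "has_bochner_integral lborel (\<lambda>t. lconv s lam U t * rconv s lam U t) (energy (2 * s) lam U)"
  unfolding energy_def lconv_def rconv_def
proof (rule gram_integral)
  show "AE q in lborel \<Otimes>\<^sub>M lborel. has_bochner_integral lborel
      (\<lambda>t. tker s lam (t - fst q) * tker s lam (snd q - t)) (tker (2 * s) lam (snd q - fst q))"
  proof (rule AE_I2)
    fix q :: "real \<times> real"
    let ?f = "\<lambda>t. tker s lam t * tker s lam ((snd q - fst q) - t)"
    have "has_bochner_integral lborel (\<lambda>t. ?f (- fst q + 1 * t)) (tker (s + s) lam (snd q - fst q) /\<^sub>R \<bar>1\<bar>)"
      using tker_beta[OF s(1) s(1)]
      by (subst lborel_has_bochner_integral_real_affine_iff[symmetric]) auto
    then show "has_bochner_integral lborel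
        (\<lambda>t. tker s lam (t - fst q) * tker s lam (snd q - t)) (tker (2 * s) lam (snd q - fst q))"
      by (simp add: mult_2 algebra_simps)
  qed
qed (use integrable_energy[OF U U2 U0 _ lam, of "2 * s"] s in \<open>auto simp: tker_nonneg\<close>)

text \<open>The difference of the two kernels has the nonnegative Laplace weight supplied by
  \<open>corr_weight_le\<close>, hence is positive definite. The factor 2 comes from
  \<open>energy_symmetric\<close>.\<close>

lemma autocorr_form:
  shows integrable_autocorr_form: "integrable (lborel \<Otimes>\<^sub>M lborel)
      (\<lambda>q. autocorr s lam \<bar>fst q - snd q\<bar> * (U (fst q) * U (snd q)))" (is ?int)
    and autocorr_form_le_energy: "(\<integral>q. autocorr s lam \<bar>fst q - snd q\<bar> * (U (fst q) * U (snd q)) \<partial>(lborel \<Otimes>\<^sub>M lborel))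
      \<le> 2 * coercivity_const s * energy (2 * s) lam U" (is ?le)
proof -
  let ?V = "\<lambda>q. U (fst q) * U (snd q)"
  let ?K = "\<lambda>q. tker (2 * s) lam \<bar>fst q - snd q\<bar>" and ?G = "\<lambda>q. autocorr s lam \<bar>fst q - snd q\<bar>"
  have s1: "0 < s" "s < 1" "0 < 2 * s" using s by auto
  have laplace: "AE q in lborel \<Otimes>\<^sub>M lborel.
      has_bochner_integral lborel (\<lambda>r. corr_weight s lam r * exp (- r * \<bar>fst q - snd q\<bar>)) (?G q) \<and>
      has_bochner_integral lborel (\<lambda>r. coercivity_const s * (laplace_weight (2 * s) lam r * exp (- r * \<bar>fst q - snd q\<bar>))) (coercivity_const s * ?K q)"
    using AE_fst_neq_snd
  proof eventually_elim
    case (elim q)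
    then show ?case using s s1 lam
      by (intro conjI has_bochner_integral_mult_right autocorr_laplace tker_eq_laplace_laplace_weight) auto
  qed
  have K: "integrable (lborel \<Otimes>\<^sub>M lborel) (\<lambda>q. coercivity_const s * (?K q * ?V q))"
    by (intro integrable_mult_right integrable_kernel_form[OF U U2 U0]) (use s1 lam in auto)
  show int: ?int
  proof (rule Bochner_Integration.integrable_bound[OF K])
    show "AE q in lborel \<Otimes>\<^sub>M lborel. norm (?G q * ?V q) \<le> norm (coercivity_const s * (?K q * ?V q))"
      using laplace
    proof eventually_elim
      case (elim q)
      \<comment> \<open>This pointwise bound yields only integrability; as U may change sign, it
        does not compare the two forms.\<close>
      have "?G q \<le> coercivity_const s * ?K q"
        unfolding has_bochner_integral_integral_eq[OF conjunct1[OF elim], symmetric]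
          has_bochner_integral_integral_eq[OF conjunct2[OF elim], symmetric]
      proof (rule Bochner_Integration.integral_mono)
        show "integrable lborel (\<lambda>r. corr_weight s lam r * exp (- r * \<bar>fst q - snd q\<bar>))"
          "integrable lborel (\<lambda>r. coercivity_const s * (laplace_weight (2 * s) lam r * exp (- r * \<bar>fst q - snd q\<bar>)))"
          using elim by (simp_all only: has_bochner_integral_iff)
        fix r
        show "corr_weight s lam r * exp (- r * \<bar>fst q - snd q\<bar>)
            \<le> coercivity_const s * (laplace_weight (2 * s) lam r * exp (- r * \<bar>fst q - snd q\<bar>))"
          using mult_right_mono[OF corr_weight_le[OF s lam, of r], of "exp (- r * \<bar>fst q - snd q\<bar>)"]
          by (simp add: mult.assoc)
      qed
      moreover have "0 \<le> ?G q"
        unfolding autocorr_def using s1 by (intro Bochner_Integration.integral_nonneg) (simp add: corr_weight_nonneg)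
      ultimately have "norm (?G q) \<le> norm (coercivity_const s * ?K q)" by simp
      then have "norm (?G q) * norm (?V q) \<le> norm (coercivity_const s * ?K q) * norm (?V q)"
        by (rule mult_right_mono) simp
      then show ?case by (simp only: norm_mult mult.assoc)
    qed
  qed measurable
  have "0 \<le> (\<integral>q. (coercivity_const s * ?K q - ?G q) * ?V q \<partial>(lborel \<Otimes>\<^sub>M lborel))"
  proof (rule laplace_positive_definite[where W = "\<lambda>r. coercivity_const s * laplace_weight (2 * s) lam r - corr_weight s lam r"])
    show "AE q in lborel \<Otimes>\<^sub>M lborel. has_bochner_integral lborel
        (\<lambda>r. (coercivity_const s * laplace_weight (2 * s) lam r - corr_weight s lam r) * exp (- r * \<bar>fst q - snd q\<bar>))
        (coercivity_const s * ?K q - ?G q)"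
      using laplace
    proof eventually_elim
      case (elim q)
      then show ?case using has_bochner_integral_diff[OF conjunct2[OF elim] conjunct1[OF elim]]
        by (simp add: algebra_simps)
    qed
    show "integrable lborel U" by (rule integrable_of_square_integrable[OF U U2 U0])
    show "integrable (lborel \<Otimes>\<^sub>M lborel) (\<lambda>q. (coercivity_const s * ?K q - ?G q) * ?V q)"
      using Bochner_Integration.integrable_diff[OF K int] by (simp add: algebra_simps)
    show "r \<le> 0 \<Longrightarrow> coercivity_const s * laplace_weight (2 * s) lam r - corr_weight s lam r = 0" for r
      using lam by (simp add: corr_weight_def laplace_weight_eq_0)
  qed (use corr_weight_le[OF s lam] in auto)
  also have "(\<integral>q. (coercivity_const s * ?K q - ?G q) * ?V q \<partial>(lborel \<Otimes>\<^sub>M lborel))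
      = (\<integral>q. coercivity_const s * (?K q * ?V q) - ?G q * ?V q \<partial>(lborel \<Otimes>\<^sub>M lborel))"
    by (simp add: algebra_simps)
  also have "\<dots> = coercivity_const s * (2 * energy (2 * s) lam U) - (\<integral>q. ?G q * ?V q \<partial>(lborel \<Otimes>\<^sub>M lborel))"
    by (simp only: Bochner_Integration.integral_diff[OF K int] integral_mult_right_zero
        energy_symmetric[OF U U2 U0 s1(3) lam])
  finally show ?le by simp
qed

lemma AE_tker_correlation_autocorr:
  "AE q in lborel \<Otimes>\<^sub>M lborel. has_bochner_integral lborel
      (\<lambda>t. tker s lam (t - fst q) * tker s lam (t - snd q)) (autocorr s lam \<bar>fst q - snd q\<bar>)"
  "AE q in lborel \<Otimes>\<^sub>M lborel. has_bochner_integral lborel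
      (\<lambda>t. tker s lam (fst q - t) * tker s lam (snd q - t)) (autocorr s lam \<bar>fst q - snd q\<bar>)"
  using AE_fst_neq_snd
  by (eventually_elim, intro tker_correlation tker_correlation_autocorr; use s lam in simp)+

text \<open>The squared norm over the whole line, including the tail beyond b, is the Gram form with
  kernel \<open>autocorr\<close>; restriction to the interval can only decrease it.\<close>

lemma lconv_square_le_energy:
  "integrable lborel (\<lambda>t. (lconv s lam U t)\<^sup>2)"
  "(\<integral>t. (lconv s lam U t)\<^sup>2 \<partial>lborel) \<le> 2 * coercivity_const s * energy (2 * s) lam U"
proof -
  have "has_bochner_integral lborel (\<lambda>t. lconv s lam U t * lconv s lam U t)
      (\<integral>q. autocorr s lam \<bar>fst q - snd q\<bar> * (U (fst q) * U (snd q)) \<partial>(lborel \<Otimes>\<^sub>M lborel))"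
    unfolding lconv_def
    by (rule gram_integral[OF _ _ U _ _ AE_tker_correlation_autocorr(1) integrable_autocorr_form])
       (use s in \<open>auto simp: tker_nonneg\<close>)
  then show "integrable lborel (\<lambda>t. (lconv s lam U t)\<^sup>2)"
    "(\<integral>t. (lconv s lam U t)\<^sup>2 \<partial>lborel) \<le> 2 * coercivity_const s * energy (2 * s) lam U"
    using autocorr_form_le_energy by (simp_all add: has_bochner_integral_iff power2_eq_square)
qed

lemma rconv_square_le_energy:
  "integrable lborel (\<lambda>t. (rconv s lam U t)\<^sup>2)"
  "(\<integral>t. (rconv s lam U t)\<^sup>2 \<partial>lborel) \<le> 2 * coercivity_const s * energy (2 * s) lam U"
proof -
  have "has_bochner_integral lborel (\<lambda>t. rconv s lam U t * rconv s lam U t)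
      (\<integral>q. autocorr s lam \<bar>fst q - snd q\<bar> * (U (fst q) * U (snd q)) \<partial>(lborel \<Otimes>\<^sub>M lborel))"
    unfolding rconv_def
    by (rule gram_integral[OF _ _ U _ _ AE_tker_correlation_autocorr(2) integrable_autocorr_form])
       (use s in \<open>auto simp: tker_nonneg\<close>)
  then show "integrable lborel (\<lambda>t. (rconv s lam U t)\<^sup>2)"
    "(\<integral>t. (rconv s lam U t)\<^sup>2 \<partial>lborel) \<le> 2 * coercivity_const s * energy (2 * s) lam U"
    using autocorr_form_le_energy by (simp_all add: has_bochner_integral_iff power2_eq_square)
qed

lemma energy_equivalence:
  fixes k Q L R :: real
  defines "k \<equiv> 2 * coercivity_const s" and "Q \<equiv> energy (2 * s) lam U"
    and "L \<equiv> (\<integral>t. indicator {a<..<b} t *\<^sub>R (lconv s lam U t)\<^sup>2 \<partial>lborel)"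
    and "R \<equiv> (\<integral>t. indicator {a<..<b} t *\<^sub>R (rconv s lam U t)\<^sup>2 \<partial>lborel)"
  shows "L \<le> k * Q" "Q \<le> k * L" "R \<le> k * Q" "Q \<le> k * R"
proof -
  let ?l = "lconv s lam U" and ?r = "rconv s lam U" and ?I = "indicator {a<..<b} :: real \<Rightarrow> real"
  have k: "0 < k" using coercivity_const_pos[OF s] by (simp add: k_def)
  have intL: "integrable lborel (\<lambda>t. ?I t *\<^sub>R (?l t)\<^sup>2)" and intR: "integrable lborel (\<lambda>t. ?I t *\<^sub>R (?r t)\<^sup>2)"
    by (intro integrable_mult_indicator lconv_square_le_energy rconv_square_le_energy; simp)+
  have "L \<le> (\<integral>t. (?l t)\<^sup>2 \<partial>lborel)"
    unfolding L_def by (intro Bochner_Integration.integral_mono intL lconv_square_le_energy) (simp add: indicator_def)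
  then show L: "L \<le> k * Q" using lconv_square_le_energy(2) by (simp add: k_def Q_def)
  have "R \<le> (\<integral>t. (?r t)\<^sup>2 \<partial>lborel)"
    unfolding R_def by (intro Bochner_Integration.integral_mono intR rconv_square_le_energy) (simp add: indicator_def)
  then show R: "R \<le> k * Q" using rconv_square_le_energy(2) by (simp add: k_def Q_def)
  \<comment> \<open>The left integral vanishes up to a and the right one from b on, so the product
    lives on (a,b). This is why the reverse estimate involves norms over the interval only.\<close>
  have vanish: "?l t * ?r t = 0" if "t \<notin> {a<..<b}" for t
  proof -
    have "?l t = 0" if "t \<le> a"
    proof -
      have "(\<lambda>y. tker s lam (t - y) * U y) = (\<lambda>_. 0)"
        using that U0 by (force simp: tker_def)
      then show ?thesis by (simp add: lconv_def)
    qed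
    moreover have "?r t = 0" if "b \<le> t"
    proof -
      have "(\<lambda>y. tker s lam (y - t) * U y) = (\<lambda>_. 0)"
        using that U0 by (force simp: tker_def)
      then show ?thesis by (simp add: rconv_def)
    qed
    ultimately show ?thesis using that by fastforce
  qed
  \<comment> \<open>AM-GM with a free weight c, chosen below so that the unwanted norm is absorbed
    into Q.\<close>
  have amgm: "Q \<le> (c * L + R / c) / 2" if c: "0 < c" for c
  proof -
    have "Q = (\<integral>t. ?l t * ?r t \<partial>lborel)"
      using energy_semigroup by (simp add: Q_def has_bochner_integral_iff)
    also have "\<dots> \<le> (\<integral>t. (c * (?I t *\<^sub>R (?l t)\<^sup>2) + (?I t *\<^sub>R (?r t)\<^sup>2) / c) / 2 \<partial>lborel)"
    proof (intro Bochner_Integration.integral_mono)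
      show "?l t * ?r t \<le> (c * (?I t *\<^sub>R (?l t)\<^sup>2) + (?I t *\<^sub>R (?r t)\<^sup>2) / c) / 2" for t
      proof (cases "t \<in> {a<..<b}")
        case True
        have "0 \<le> (c * ?l t - ?r t)\<^sup>2 / c" using c by simp
        also have "\<dots> = c * (?l t)\<^sup>2 + (?r t)\<^sup>2 / c - 2 * (?l t * ?r t)"
          using c by (simp add: field_simps power2_eq_square)
        finally show ?thesis using True by simp
      qed (simp add: vanish del: mult_eq_0_iff)
    qed (use energy_semigroup intL intR in \<open>auto simp: has_bochner_integral_iff\<close>)
    also have "\<dots> = (c * L + R / c) / 2"
      using intL intR by (simp add: L_def R_def)
    finally show ?thesis .
  qed
  \<comment> \<open>With c = k, Q <= (k L + R/k)/2 <= (k L + Q)/2 and Q/2 is absorbed; c = 1/k does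
    the same with L and R exchanged.\<close>
  have "R / k \<le> Q" using R k by (simp add: field_simps)
  then show "Q \<le> k * L" using amgm[OF k] by simp
  have "inverse k * L \<le> Q" using L k by (simp add: field_simps)
  moreover have "R / inverse k = k * R" by (simp add: field_simps)
  ultimately show "Q \<le> k * R" using amgm[of "inverse k"] k by simp
qed

end

section \<open>Transfer to the interval\<close>

theorem theorem3:
  fixes a b lam mu :: real
  assumes "a < b" and "0 \<le> lam" and "0 < mu" and "mu < 1"
  shows "\<exists>C1 C2 C3 C4. 0 < C1 \<and> 0 < C2 \<and> 0 < C3 \<and> 0 < C4 \<and>
    (\<forall>u. in_L2 a b u \<longrightarrow>
       C1 * L2_norm_sq a b (left_tfi a (mu/2) lam u) \<le> L2_inner a b (left_tfi a mu lam u) u \<and>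
       L2_inner a b (left_tfi a mu lam u) u \<le> C2 * L2_norm_sq a b (left_tfi a (mu/2) lam u) \<and>
       L2_inner a b (left_tfi a mu lam u) u = L2_inner a b u (right_tfi b mu lam u) \<and>
       C3 * L2_norm_sq a b (right_tfi b (mu/2) lam u) \<le> L2_inner a b u (right_tfi b mu lam u) \<and>
       L2_inner a b u (right_tfi b mu lam u) \<le> C4 * L2_norm_sq a b (right_tfi b (mu/2) lam u))"
proof -
  \<comment> \<open>By the reflection formula k = 1 / cos (pi mu / 2): all four constants depend on
    mu alone.\<close>
  define k where "k = 2 * coercivity_const (mu/2)"
  have s: "0 < mu/2" "2 * (mu/2) < 1" using assms by auto
  have k: "0 < k" using coercivity_const_pos[OF s] by (simp add: k_def)
  have main: "1 / k * L2_norm_sq a b (left_tfi a (mu/2) lam u) \<le> L2_inner a b (left_tfi a mu lam u) u \<and>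
       L2_inner a b (left_tfi a mu lam u) u \<le> k * L2_norm_sq a b (left_tfi a (mu/2) lam u) \<and>
       L2_inner a b (left_tfi a mu lam u) u = L2_inner a b u (right_tfi b mu lam u) \<and>
       1 / k * L2_norm_sq a b (right_tfi b (mu/2) lam u) \<le> L2_inner a b u (right_tfi b mu lam u) \<and>
       L2_inner a b u (right_tfi b mu lam u) \<le> k * L2_norm_sq a b (right_tfi b (mu/2) lam u)"
    if u: "in_L2 a b u" for u
  proof -
    define U where "U = (\<lambda>x. indicator {a<..<b} x *\<^sub>R u x)"
    have U: "U \<in> borel_measurable lborel"
      using u by (simp add: in_L2_def set_borel_measurable_def U_def)
    have "(\<lambda>x. (U x)\<^sup>2) = (\<lambda>x. indicator {a<..<b} x *\<^sub>R (u x)\<^sup>2)"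
      by (auto simp: U_def indicator_def)
    then have U2: "integrable lborel (\<lambda>x. (U x)\<^sup>2)"
      using u by (simp add: in_L2_def set_integrable_def)
    have U0: "\<forall>x. x \<notin> {a<..<b} \<longrightarrow> U x = 0"
      by (simp add: U_def)
    have left: "left_tfi a p lam u x = lconv p lam U x" and right: "right_tfi b p lam u x = rconv p lam U x"
      if "x \<in> {a<..<b}" for p x
      using that left_tfi_eq_lconv[of x b a] right_tfi_eq_rconv[of a x b] by (auto simp: U_def)
    have "L2_inner a b (left_tfi a mu lam u) u = (\<integral>x. lconv mu lam U x * U x \<partial>lborel)"
      unfolding L2_inner_def set_lebesgue_integral_def
      by (intro Bochner_Integration.integral_cong) (auto simp: U_def[THEN fun_cong] left indicator_def)
    then have inner_left: "L2_inner a b (left_tfi a mu lam u) u = energy mu lam U"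
      using energy_eq_lconv[OF U U2 U0 assms(3,2)] by simp
    have "L2_inner a b u (right_tfi b mu lam u) = (\<integral>x. U x * rconv mu lam U x \<partial>lborel)"
      unfolding L2_inner_def set_lebesgue_integral_def
      by (intro Bochner_Integration.integral_cong) (auto simp: U_def[THEN fun_cong] right indicator_def)
    then have inner_right: "L2_inner a b u (right_tfi b mu lam u) = energy mu lam U"
      using energy_eq_rconv[OF U U2 U0 assms(3,2)] by simp
    \<comment> \<open>In the inner products U itself restricts to (a,b). The norms must keep the
      indicator, since \<open>lconv\<close> can be nonzero beyond b.\<close>
    have norm_left: "L2_norm_sq a b (left_tfi a (mu/2) lam u)
        = (\<integral>t. indicator {a<..<b} t *\<^sub>R (lconv (mu/2) lam U t)\<^sup>2 \<partial>lborel)"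
      unfolding L2_norm_sq_def set_lebesgue_integral_def
      by (intro Bochner_Integration.integral_cong) (auto simp: left indicator_def)
    have norm_right: "L2_norm_sq a b (right_tfi b (mu/2) lam u)
        = (\<integral>t. indicator {a<..<b} t *\<^sub>R (rconv (mu/2) lam U t)\<^sup>2 \<partial>lborel)"
      unfolding L2_norm_sq_def set_lebesgue_integral_def
      by (intro Bochner_Integration.integral_cong) (auto simp: right indicator_def)
    note eq = energy_equivalence[OF U U2 U0 s assms(2), folded k_def norm_left norm_right]
    show ?thesis
      using eq k unfolding inner_left inner_right by (simp add: field_simps)
  qed
  show ?thesis
    by (rule exI[of _ "1 / k"], rule exI[of _ k], rule exI[of _ "1 / k"], rule exI[of _ k])
       (intro conjI allI impI main; use k in simp)
qed

end
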